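(* Let $(X,d)$ be a metric space with base point $x_0$, and let $g$ be an isometry of $X$ whose displacement is zero, i.e. $\inf_{x\in X} d(x,g(x))=0$. Then there is a metric functional $h$ of $X$ which is invariant in the strong sense that $h(gx)=h(x)$ for all $x\in X$.
   Context: For $x\in X$ define $h_x:X\to\mathbb{R}$ by $h_x(y)=d(y,x)-d(x_0,x)$. The metric functionals of $X$ are the elements of the closure $\overline{X}$ of $\{h_x:x\in X\}$ in $\mathbb{R}^X$ with the topology of pointwise convergence. *)

theory Defs
  imports "HOL-Analysis.Analysis"
begin

definition internal_functional :: "'a::metric_space \<Rightarrow> 'a \<Rightarrow> 'a \<Rightarrow> real" where
  "internal_functional x0 x = (\<lambda>y. dist y x - dist x0 x)"

text \<open>The topology on \<open>'a \<Rightarrow> real\<close> provided by the type class instance in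
  \<^theory>\<open>HOL-Analysis.Function_Topology\<close> is the product topology, that is, the topology of
  pointwise convergence.\<close>

definition metric_functionals :: "'a::metric_space \<Rightarrow> ('a \<Rightarrow> real) set" where
  "metric_functionals x0 = closure (range (internal_functional x0))"

text \<open>Isometries are distance-preserving self-maps; surjectivity is not required, so isometric
  bijections are included as a special case.\<close>

definition isometry :: "('a::metric_space \<Rightarrow> 'a) \<Rightarrow> bool" where
  "isometry g \<longleftrightarrow> (\<forall>x y. dist (g x) (g y) = dist x y)"

end

theory Submission
  imports Defs
begin

text \<open>
  The functional \<open>h\<^sub>x\<close> of a point \<open>x\<close> is almost invariant under an isometry \<open>g\<close> that moves \<open>x\<close> only
  slightly: \<open>h\<^sub>x (g y) - h\<^sub>x y = d (g y, x) - d (g y, g x)\<close>, which is at most \<open>d (x, g x)\<close> in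
  absolute value, uniformly in \<open>y\<close>.  If the displacement of \<open>g\<close> is zero, then for every
  \<open>\<epsilon> > 0\<close> there is therefore a metric functional that \<open>g\<close> changes by at most \<open>\<epsilon>\<close>.  For a fixed
  \<open>\<epsilon>\<close> these functionals form a closed set, because each condition involves only two values of
  the functional, and these sets shrink with \<open>\<epsilon>\<close>.  By Tychonoff's theorem the space of metric
  functionals is compact, so the sets have a common point, and this point is exactly invariant.
\<close>

text \<open>
  The triangle inequality confines the value of every \<open>h\<^sub>x\<close> at \<open>y\<close> to the compact interval
  \<open>[- d (y, x\<^sub>0), d (y, x\<^sub>0)]\<close>, which does not depend on \<open>x\<close>.  The closure thus lies in a product
  of compact intervals.
\<close>

lemma compact_metric_functionals: "compact (metric_functionals x0)"
proof -
  let ?K = "\<Pi>\<^sub>E y\<in>UNIV. {- dist y x0 .. dist y x0}"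
  have "compactin (product_topology (\<lambda>_. euclidean) UNIV) ?K"
    by (simp add: compactin_PiE)
  then have "compact ?K"
    by (simp add: euclidean_product_topology)
  moreover have "closed ?K"
    using closedin_product_topology[of "\<lambda>_. euclidean" UNIV "\<lambda>y. {- dist y x0 .. dist y x0}"]
    by (simp add: euclidean_product_topology)
  moreover have "range (internal_functional x0) \<subseteq> ?K"
  proof -
    have "- dist y x0 \<le> dist y x - dist x0 x" "dist y x - dist x0 x \<le> dist y x0" for x y
      using dist_triangle[of y x x0] dist_triangle[of x0 x y] by (simp_all add: dist_commute)
    then show ?thesis
      by (auto simp: internal_functional_def)
  qed
  ultimately have "metric_functionals x0 = ?K \<inter> metric_functionals x0"
    using closure_minimal[of "range (internal_functional x0)" ?K]
    by (auto simp only: metric_functionals_def)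
  moreover have "closed (metric_functionals x0)"
    by (simp add: metric_functionals_def)
  ultimately show ?thesis
    using compact_Int_closed[OF \<open>compact ?K\<close>] by metis
qed

lemma internal_functional_almost_invariant:
  assumes "isometry g"
  shows "\<bar>internal_functional x0 x (g y) - internal_functional x0 x y\<bar> \<le> dist x (g x)"
proof -
  have "internal_functional x0 x (g y) - internal_functional x0 x y
      = dist (g y) x - dist (g y) (g x)"
    using assms by (simp add: internal_functional_def isometry_def)
  also have "\<bar>\<dots>\<bar> \<le> dist x (g x)"
    using dist_triangle[of "g y" x "g x"] dist_triangle[of "g y" "g x" x]
    by (simp add: dist_commute)
  finally show ?thesis .
qed

lemma closed_almost_invariant:
  fixes g :: "'a \<Rightarrow> 'a"
  shows "closed {h :: 'a \<Rightarrow> real. \<forall>y. \<bar>h (g y) - h y\<bar> \<le> e}"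
  by (intro closed_Collect_all closed_Collect_le continuous_intros
      continuous_on_product_coordinates)

theorem corollary14:
  fixes x0 :: "'a::metric_space" and g :: "'a \<Rightarrow> 'a"
  assumes "isometry g"
    and "(INF x. dist x (g x)) = 0"
  shows "\<exists>h \<in> metric_functionals x0. \<forall>x. h (g x) = h x"
proof -
  define C where "C e = {h :: 'a \<Rightarrow> real. \<forall>y. \<bar>h (g y) - h y\<bar> \<le> e}" for e
  have "metric_functionals x0 \<inter> (\<Inter>e\<in>{0<..}. C e) \<noteq> {}"
  proof (rule compact_imp_fip_image[OF compact_metric_functionals])
    show "closed (C e)" for e
      unfolding C_def by (rule closed_almost_invariant)
  next
    fix E :: "real set"
    assume E: "finite E" "E \<subseteq> {0<..}"
    \<comment> \<open>The bound \<open>1\<close> only keeps the minimum defined when \<open>E\<close> is empty.\<close>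
    define m where "m = Min (insert 1 E)"
    have "m > 0"
      using E by (auto simp: m_def)
    moreover have "bdd_below (range (\<lambda>x. dist x (g x)))"
      by (rule bdd_belowI2[of _ 0]) simp
    ultimately obtain x where x: "dist x (g x) < m"
      using assms(2) cINF_less_iff[of UNIV "\<lambda>x. dist x (g x)" m] by auto
    have "internal_functional x0 x \<in> C e" if "e \<in> E" for e
    proof -
      have "m \<le> e"
        using that E by (simp add: m_def)
      then have "dist x (g x) \<le> e"
        using x by simp
      then have "\<bar>internal_functional x0 x (g y) - internal_functional x0 x y\<bar> \<le> e" for y
        using internal_functional_almost_invariant[OF assms(1)] by (rule order_trans[rotated])
      then show ?thesis
        by (simp add: C_def)
    qed
    moreover have "internal_functional x0 x \<in> metric_functionals x0"
      unfolding metric_functionals_def by (rule subsetD[OF closure_subset rangeI])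
    ultimately show "metric_functionals x0 \<inter> (\<Inter>e\<in>E. C e) \<noteq> {}"
      by blast
  qed
  then obtain h where h: "h \<in> metric_functionals x0" "h \<in> (\<Inter>e\<in>{0<..}. C e)"
    by blast
  then have *: "\<bar>h (g y) - h y\<bar> \<le> e" if "e > 0" for e y
    using that by (simp add: C_def)
  have "h (g y) = h y" for y
  proof -
    have "\<bar>h (g y) - h y\<bar> \<le> 0"
      by (rule field_le_epsilon) (simp add: *)
    then show ?thesis
      by simp
  qed
  with h(1) show ?thesis
    by blast
qed

end
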